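(* Let $S$ be a numerical semigroup, let $s\in S$ be nonzero, and let $Ap_s(S)=\{a_0,a_1,\dots,a_{s-1}\}$ be its Apéry set, with $a_k\equiv k \pmod s$. Then for each $k\in I_s=\{0,1,\dots,s-1\}$ $$ q^{s\left[\frac{a_k}{s}\right]}=1+\frac{q^s-1}{sq^k}\sum_{j=0}^{s-1}\epsilon_s^{-jk}C_{S}(\epsilon_s^jq), $$ $$ \left[\frac{a_k}{s}\right]=\frac{1}{s}\sum_{j=0}^{s-1}\epsilon_s^{-jk}C_{S}(\epsilon_s^j). $$ In particular, for coprime positive integers $a,b$ and each $k\in I_b=\{0,1,\dots,b-1\}$ $$ q^{b\left[\frac{ak}{b}\right]}=1+\frac{q^b-1}{bq^{\pi(k)}}\sum_{j=0}^{b-1}\epsilon_b^{-jak}C_{S_{a,b}}(\epsilon_b^jq), $$ $$ \left[\frac{ak}{b}\right]=\frac{1}{b}\sum_{j=0}^{b-1}\epsilon_b^{-jak}C_{S_{a,b}}(\epsilon_b^j). $$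
   Context: A numerical semigroup is a set $S\subset\mathbb Z_{\ge 0}$ that contains $0$, is closed under addition, and has finite complement $C_S:=\mathbb Z_{\ge 0}\setminus S$. Put $C_S(q):=\sum_{k\in C_S}q^k$, a polynomial in the variable $q$. For nonzero $s\in S$ and $I_s:=\{0,1,\dots,s-1\}$, the Apéry set is $Ap_s(S):=\{u\in S:u-s\notin S\}=\{a_0,a_1,\dots,a_{s-1}\}$, where $a_k:=\min((k+s\mathbb Z_{\ge 0})\cap S)$ for $k\in I_s$. For coprime positive integers $a,b$, $S_{a,b}$ denotes the numerical semigroup generated by $a$ and $b$, i.e. $S_{a,b}=\{xa+yb: x,y\in\mathbb Z_{\ge 0}\}$, and $C_{S_{a,b}}(q)$ is the corresponding polynomial. For $k\in I_b$, $\pi(k)\in I_b$ is the remainder of $ak$ modulo $b$. $[x]$ is the integer part (floor) of $x$, and $\epsilon_n:=e^{2\pi i/n}$ with $i=\sqrt{-1}$. The identities containing $q$ are identities of Laurent polynomials in the variable $q$ with complex coefficients. *)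

theory Defs
  imports
    Complex_Main
    "HOL-Computational_Algebra.Computational_Algebra"
    "HOL-Number_Theory.Cong"
begin

definition numerical_semigroup :: "nat set \<Rightarrow> bool" where
  "numerical_semigroup S \<longleftrightarrow>
     0 \<in> S \<and> (\<forall>x\<in>S. \<forall>y\<in>S. x + y \<in> S) \<and> finite (- S)"

text \<open>The polynomial \<open>C\<^sub>S(q) = \<Sum>k\<in>C\<^sub>S. q^k\<close>, where \<open>C\<^sub>S\<close> is the complement
  of \<open>S\<close> in the non-negative integers.\<close>

definition gap_poly :: "nat set \<Rightarrow> complex poly" where
  "gap_poly S = (\<Sum>k\<in>- S. monom 1 k)"

text \<open>The difference \<open>u - s\<close> is taken in the integers, since subtraction on
  \<^typ>\<open>nat\<close> truncates.\<close>

definition apery_set :: "nat set \<Rightarrow> nat \<Rightarrow> nat set" where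
  "apery_set S s = {u \<in> S. int u - int s \<notin> int ` S}"

definition apery_elem :: "nat set \<Rightarrow> nat \<Rightarrow> nat \<Rightarrow> nat" where
  "apery_elem S s k = (LEAST n. n \<in> {k + s * t |t. True} \<inter> S)"

definition semigroup2 :: "nat \<Rightarrow> nat \<Rightarrow> nat set" where
  "semigroup2 a b = {x * a + y * b |x y. True}"

definition eps :: "nat \<Rightarrow> complex" where
  "eps n = exp (2 * of_real pi * \<i> / of_nat n)"

text \<open>Laurent polynomials over the complex numbers form a subring of the field
  \<^typ>\<open>complex fls\<close> of formal Laurent series, with \<^term>\<open>fls_X\<close> as the variable
  \<open>q\<close>; identities of Laurent polynomials are stated there. The following is
  the value \<open>p(x)\<close> of a complex polynomial \<open>p\<close> at such an element \<open>x\<close>.\<close>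

definition laurent_eval :: "complex poly \<Rightarrow> complex fls \<Rightarrow> complex fls" where
  "laurent_eval p x = poly (map_poly fls_const p) x"

text \<open>An enumeration of the Apery set by residues modulo \<open>s\<close> exists, and it
  necessarily consists of the minima \<^const>\<open>apery_elem\<close>.\<close>

lemma apery_elem_props:
  assumes S: "numerical_semigroup S" and s: "s \<in> S" "s \<noteq> 0"
  shows "apery_elem S s k \<in> S" "\<exists>t. apery_elem S s k = k + s * t"
    and "n \<in> S \<Longrightarrow> n = k + s * t \<Longrightarrow> apery_elem S s k \<le> n"
proof -
  obtain m where m: "\<And>x. x \<notin> S \<Longrightarrow> x < m"
    using S finite_nat_set_iff_bounded[of "- S"] unfolding numerical_semigroup_def by auto
  have "m \<le> k + s * m" using s by (simp add: trans_le_add2)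
  hence "k + s * m \<in> S" using m by (meson not_le)
  hence "k + s * m \<in> {k + s * t |t. True} \<inter> S" by auto
  from LeastI[of "\<lambda>n. n \<in> {k + s * t |t. True} \<inter> S", OF this]
  show "apery_elem S s k \<in> S" "\<exists>t. apery_elem S s k = k + s * t"
    unfolding apery_elem_def by auto
  show "n \<in> S \<Longrightarrow> n = k + s * t \<Longrightarrow> apery_elem S s k \<le> n"
    unfolding apery_elem_def by (rule Least_le) auto
qed

lemma apery_elem_cong:
  assumes "numerical_semigroup S" "s \<in> S" "s \<noteq> 0"
  shows "[apery_elem S s k = k] (mod s)"
  using apery_elem_props(2)[OF assms, of k] by (auto simp: cong_def)

lemma apery_set_eq_apery_elem:
  assumes S: "numerical_semigroup S" and s: "s \<in> S" "s \<noteq> 0"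
    and n: "n \<in> apery_set S s" and k: "k < s" "[n = k] (mod s)"
  shows "n = apery_elem S s k"
proof -
  let ?a = "apery_elem S s k"
  have nS: "n \<in> S" using n by (simp add: apery_set_def)
  have nk: "n = k + s * (n div s)" using k unfolding cong_def
    by (metis add.commute mod_less mult_div_mod_eq)
  obtain t where t: "?a = k + s * t" using apery_elem_props(2)[OF S s] by blast
  have le: "?a \<le> n" using apery_elem_props(3)[OF S s nS nk] .
  have mult: "?a + s * i \<in> S" for i
  proof (induction i)
    case 0 show ?case using apery_elem_props(1)[OF S s] by simp
  next
    case (Suc i)
    hence "?a + s * i + s \<in> S" using S s unfolding numerical_semigroup_def by blast
    thus ?case by (simp add: algebra_simps)
  qed
  show ?thesis
  proof (rule ccontr)
    assume "n \<noteq> ?a"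
    hence "k + s * t < k + s * (n div s)" using le t nk by linarith
    hence "t < n div s" by simp
    then obtain i where "n div s = t + Suc i" using less_iff_Suc_add by auto
    hence e: "n = (?a + s * i) + s" using nk t by (simp add: algebra_simps)
    hence "int n - int s = int (?a + s * i)" by simp
    hence "int n - int s \<in> int ` S" using mult[of i] by (metis imageI)
    thus False using n by (simp add: apery_set_def)
  qed
qed

lemma apery_set_eq_image:
  assumes S: "numerical_semigroup S" and s: "s \<in> S" "s \<noteq> 0"
  shows "apery_set S s = apery_elem S s ` {..<s}"
proof (intro equalityI subsetI)
  fix n assume "n \<in> apery_set S s"
  moreover have "n mod s < s" using s by simp
  ultimately show "n \<in> apery_elem S s ` {..<s}"
    using apery_set_eq_apery_elem[OF S s, of n "n mod s"] by (auto simp: cong_def)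
next
  fix n assume "n \<in> apery_elem S s ` {..<s}"
  then obtain k where k: "k < s" "n = apery_elem S s k" by auto
  obtain t where t: "n = k + s * t" using apery_elem_props(2)[OF S s] k by blast
  have "int n - int s \<notin> int ` S"
  proof
    assume "int n - int s \<in> int ` S"
    then obtain m where m: "m \<in> S" "n = m + s" by force
    hence "t \<noteq> 0" using t k by (cases t) auto
    then obtain t' where "t = Suc t'" by (cases t) auto
    hence "m = k + s * t'" using m t by simp
    from apery_elem_props(3)[OF S s m(1) this] show False using k m s by simp
  qed
  thus "n \<in> apery_set S s"
    using apery_elem_props(1)[OF S s] k unfolding apery_set_def by auto
qed

lemma apery_enumeration_unique:
  assumes "numerical_semigroup S" "s \<in> S" "s \<noteq> 0"
    and "apery_set S s = a ` {..<s}" "\<forall>k<s. [a k = k] (mod s)" "k < s"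
  shows "a k = apery_elem S s k"
  using assms by (intro apery_set_eq_apery_elem) auto

end

theory Submission
  imports Defs
begin

text \<open>
  Both identities in each pair are discrete Fourier inversion over \<open>\<int>/s\<close>. Averaging
  \<open>C\<^sub>S(\<epsilon>\<^sup>j q)\<close> against the character \<open>\<epsilon>\<^bsup>-jk\<^esup>\<close> extracts from the gap polynomial
  the part supported on the residue class of \<open>k\<close> (lemma \<open>gap_sum_root_filter\<close>).
  Since \<open>S\<close> is closed under adding \<open>s\<close>, the gaps in that class form an unbroken
  progression \<open>k, k + s, k + 2s, \<dots>\<close> stopping just below the Apery element
  \<open>u\<close> of the class, so there are exactly \<open>u div s\<close> of them (lemma \<open>gaps_in_class\<close>).
  The extracted part is therefore a geometric sum: multiplying by \<open>q\<^sup>s - 1\<close> telescopes it to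
  \<open>q\<^bsup>s (u div s)\<^esup> - 1\<close>, and putting \<open>q = 1\<close> counts its terms.

  For \<open>S = \<langle>a, b\<rangle>\<close> and \<open>s = b\<close>, the element \<open>a k\<close> with \<open>k < b\<close> is the Apery
  element of its own residue class, because coprimality makes the coefficient of \<open>a\<close> unique
  modulo \<open>b\<close> (lemma \<open>multiple_in_apery_set\<close>); the second pair of
  identities is then the first pair at the class of \<open>a k\<close>. To serve both pairs at once, the
  exponent in the character is kept as an arbitrary integer congruent to \<open>u\<close> modulo \<open>s\<close>.
\<close>

section \<open>Roots of unity\<close>

lemma eps_power_eq_cis: "eps s ^ j = cis (2 * pi * real j / real s)"
  by (simp add: eps_def cis_conv_exp flip: exp_of_nat_mult) (simp add: field_simps)

lemma eps_nonzero [simp]: "eps s \<noteq> 0"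
  by (simp add: eps_def)

lemma eps_power_self: "s \<noteq> 0 \<Longrightarrow> eps s ^ s = 1"
  by (simp add: eps_power_eq_cis)

lemma eps_powi_mod:
  assumes "s \<noteq> 0"
  shows "eps s powi d = eps s ^ nat (d mod int s)"
proof -
  have "eps s powi d = eps s powi (int s * (d div int s) + d mod int s)"
    by simp
  also have "\<dots> = (eps s powi int s) powi (d div int s) * eps s powi (d mod int s)"
    by (simp only: power_int_add power_int_mult eps_nonzero simp_thms)
  also have "eps s powi int s = 1"
    using assms by (simp add: eps_power_self)
  also have "eps s powi (d mod int s) = eps s ^ nat (d mod int s)"
    using assms by (simp add: power_int_def)
  finally show ?thesis
    by simp
qed

lemma eps_powi_eq_1_iff:
  assumes "s \<noteq> 0"
  shows "eps s powi d = 1 \<longleftrightarrow> int s dvd d"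
proof
  assume "eps s powi d = 1"
  hence "eps s ^ nat (d mod int s) = eps s ^ 0"
    using assms by (simp add: eps_powi_mod)
  moreover have "inj_on (\<lambda>j. eps s ^ j) {..<s}"
    using bij_betw_roots_unity[of s] assms by (simp add: eps_power_eq_cis bij_betw_def)
  moreover have "nat (d mod int s) < s"
    using assms by (simp add: nat_less_iff)
  ultimately have "nat (d mod int s) = 0"
    using assms by (metis inj_onD lessThan_iff neq0_conv)
  hence "d mod int s \<le> 0"
    by simp
  moreover have "d mod int s \<ge> 0"
    using assms by simp
  ultimately show "int s dvd d"
    by (intro dvd_eq_mod_eq_0[THEN iffD2] order_antisym)
next
  assume "int s dvd d"
  thus "eps s powi d = 1"
    using assms by (simp add: eps_powi_mod)
qed

lemma sum_eps_powi:
  assumes "s \<noteq> 0"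
  shows "(\<Sum>j<s. (eps s powi d) ^ j) = (if int s dvd d then of_nat s else 0)"
proof (cases "int s dvd d")
  case True
  hence "eps s powi d = 1"
    by (simp only: eps_powi_eq_1_iff[OF assms])
  thus ?thesis
    using True by simp
next
  case False
  have "(eps s powi d) ^ s = (eps s ^ s) powi d"
    by (metis mult.commute power_int_mult power_int_of_nat)
  thus ?thesis
    using False assms eps_powi_eq_1_iff[OF assms, of d]
    by (simp add: sum_gp_strict eps_power_self)
qed

section \<open>Gaps in a residue class\<close>

lemma add_multiple_mem:
  assumes "numerical_semigroup S" "s \<in> S" "u \<in> S"
  shows "u + s * i \<in> S"
proof (induction i)
  case (Suc i)
  hence "(u + s * i) + s \<in> S"
    using assms by (simp add: numerical_semigroup_def)
  thus ?case
    by (simp add: algebra_simps)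
qed (use assms in simp)

text \<open>
  Had some \<open>u mod s + s i\<close> with \<open>i < u div s\<close> been in \<open>S\<close>, adding multiples of \<open>s\<close>
  would put \<open>u - s\<close> into \<open>S\<close>; from \<open>u\<close> on, the same closure keeps the class inside \<open>S\<close>.
\<close>

lemma gaps_in_class:
  assumes S: "numerical_semigroup S" and s: "s \<in> S" "s \<noteq> 0" and u: "u \<in> apery_set S s"
  shows "{n \<in> - S. n mod s = u mod s} = (\<lambda>i. u mod s + s * i) ` {..<u div s}"
proof (intro equalityI subsetI)
  fix n assume "n \<in> {n \<in> - S. n mod s = u mod s}"
  hence n: "n \<notin> S" "n mod s = u mod s"
    by auto
  have "n div s < u div s"
  proof (rule ccontr)
    assume "\<not> n div s < u div s"
    then obtain i where i: "n div s = u div s + i"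
      using le_iff_add not_less by blast
    have "n = u + s * i"
      using i n(2) by (metis add.assoc add.commute distrib_left mod_mult_div_eq)
    thus False
      using add_multiple_mem[OF S s(1)] u n(1) by (auto simp: apery_set_def)
  qed
  moreover have "n = u mod s + s * (n div s)"
    using n(2) by (metis mod_mult_div_eq)
  ultimately show "n \<in> (\<lambda>i. u mod s + s * i) ` {..<u div s}"
    by blast
next
  fix n assume "n \<in> (\<lambda>i. u mod s + s * i) ` {..<u div s}"
  then obtain i where i: "i < u div s" "n = u mod s + s * i"
    by auto
  then obtain l where l: "u div s = i + Suc l"
    using less_iff_Suc_add by auto
  have eq: "u = (n + s * l) + s"
  proof -
    have "u = u mod s + s * (u div s)"
      by simp
    thus ?thesis
      unfolding i(2) l by (simp add: algebra_simps)
  qed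
  have "n \<notin> S"
  proof
    assume "n \<in> S"
    hence "n + s * l \<in> S"
      by (rule add_multiple_mem[OF S s(1)])
    moreover have "int u - int s = int (n + s * l)"
      using eq by linarith
    ultimately have "int u - int s \<in> int ` S"
      by (metis imageI)
    thus False
      using u by (simp add: apery_set_def)
  qed
  thus "n \<in> {n \<in> - S. n mod s = u mod s}"
    using i s by simp
qed

text \<open>
  Fourier inversion on the gaps. The ring homomorphism \<open>h\<close> carries the roots of unity into the
  coefficient ring of the weights \<open>w\<close>: with \<open>h = fls_const\<close>, \<open>w n = q\<^sup>n\<close> it
  gives the identity in \<open>q\<close>, and with \<open>h = id\<close>, \<open>w n = 1\<close> the one at \<open>q = 1\<close>.
\<close>

lemma gap_sum_root_filter:
  fixes h :: "complex \<Rightarrow> 'a :: comm_ring_1" and w :: "nat \<Rightarrow> 'a"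
  assumes h: "h 0 = 0" "h 1 = 1" "\<And>x y. h (x + y) = h x + h y" "\<And>x y. h (x * y) = h x * h y"
  assumes S: "numerical_semigroup S" and s: "s \<in> S" "s \<noteq> 0" and u: "u \<in> apery_set S s"
    and m: "[m = int u] (mod int s)"
  shows "(\<Sum>j<s. h (eps s powi - (int j * m)) * (\<Sum>n\<in>- S. h (eps s ^ j) ^ n * w n)) =
    of_nat s * (\<Sum>i<u div s. w (u mod s + s * i))"
proof -
  have h_sum: "h (\<Sum>j\<in>A. f j) = (\<Sum>j\<in>A. h (f j))" for A :: "nat set" and f
    by (induction A rule: infinite_finite_induct) (simp_all add: h)
  have h_pow: "h x ^ n = h (x ^ n)" for x n
    by (induction n) (simp_all add: h)
  have h_nat: "h (of_nat n) = of_nat n" for n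
    by (induction n) (simp_all add: h)
  have fin: "finite (- S)"
    using S by (simp add: numerical_semigroup_def)
  have inj: "inj_on (\<lambda>i. u mod s + s * i) {..<u div s}"
    using s(2) by (simp add: inj_on_def)
  have term_eq: "h (eps s powi - (int j * m)) * h (eps s ^ j) ^ n =
      h ((eps s powi (int n - m)) ^ j)" for j n
  proof -
    have "(eps s ^ j) ^ n = eps s powi (int j * int n)"
      by (metis of_nat_mult power_int_of_nat power_mult)
    hence "eps s powi - (int j * m) * (eps s ^ j) ^ n =
        eps s powi (- (int j * m) + int j * int n)"
      by (simp only: power_int_add eps_nonzero simp_thms)
    also have "- (int j * m) + int j * int n = (int n - m) * int j"
      by (simp add: algebra_simps)
    also have "eps s powi \<dots> = (eps s powi (int n - m)) ^ j"
      by (simp add: power_int_mult)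
    finally show ?thesis
      by (simp add: h_pow flip: h(4))
  qed
  have dvd: "int s dvd int n - m \<longleftrightarrow> n mod s = u mod s" for n
  proof -
    have "int s dvd int n - m \<longleftrightarrow> [int n = m] (mod int s)"
      by (simp add: cong_iff_dvd_diff)
    also have "\<dots> \<longleftrightarrow> [int n = int u] (mod int s)"
      using m cong_trans cong_sym by blast
    also have "\<dots> \<longleftrightarrow> n mod s = u mod s"
      by (simp add: cong_int_iff) (simp add: cong_def)
    finally show ?thesis .
  qed
  have "(\<Sum>j<s. h (eps s powi - (int j * m)) * (\<Sum>n\<in>- S. h (eps s ^ j) ^ n * w n)) =
      (\<Sum>n\<in>- S. \<Sum>j<s. h ((eps s powi (int n - m)) ^ j) * w n)"
    by (subst sum.swap) (simp add: sum_distrib_left flip: term_eq mult.assoc)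
  also have "\<dots> = (\<Sum>n\<in>- S. h (\<Sum>j<s. (eps s powi (int n - m)) ^ j) * w n)"
    by (simp add: h_sum sum_distrib_right)
  also have "\<dots> = (\<Sum>n\<in>- S. if n mod s = u mod s then of_nat s * w n else 0)"
    by (intro sum.cong refl) (simp add: sum_eps_powi[OF s(2)] dvd h h_nat)
  also have "\<dots> = (\<Sum>n\<in>{n \<in> - S. n mod s = u mod s}. of_nat s * w n)"
    by (rule sum.inter_filter[OF fin, symmetric])
  also have "\<dots> = (\<Sum>i<u div s. of_nat s * w (u mod s + s * i))"
    unfolding gaps_in_class[OF S s u] sum.reindex[OF inj] by simp
  finally show ?thesis
    by (simp add: sum_distrib_left)
qed

section \<open>The identities at one Apery element\<close>

lemma poly_gap_poly: "poly (gap_poly S) x = (\<Sum>n\<in>- S. x ^ n)"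
  by (simp add: gap_poly_def poly_sum poly_monom)

lemma laurent_eval_gap_poly:
  assumes "finite (- S)"
  shows "laurent_eval (gap_poly S) x = (\<Sum>n\<in>- S. x ^ n)"
proof -
  have "map_poly fls_const (gap_poly S) = (\<Sum>n\<in>- S. monom 1 n)"
    using assms
    by (intro poly_eqI) (simp add: gap_poly_def coeff_map_poly coeff_sum)
  thus ?thesis
    by (simp add: laurent_eval_def poly_sum poly_monom)
qed

lemma apery_laurent_identity:
  assumes S: "numerical_semigroup S" and s: "s \<in> S" "s \<noteq> 0" and u: "u \<in> apery_set S s"
    and m: "[m = int u] (mod int s)"
  shows "fls_X powi (int s * \<lfloor>real u / real s\<rfloor>) =
    1 + (fls_X ^ s - 1) / (of_nat s * fls_X ^ (u mod s)) *
      (\<Sum>j<s. fls_const (eps s powi - (int j * m)) *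
        laurent_eval (gap_poly S) (fls_const (eps s ^ j) * fls_X))"
proof -
  let ?X = "fls_X :: complex fls"
  have "finite (- S)"
    using S by (simp add: numerical_semigroup_def)
  hence "(\<Sum>j<s. fls_const (eps s powi - (int j * m)) *
        laurent_eval (gap_poly S) (fls_const (eps s ^ j) * ?X)) =
      of_nat s * (\<Sum>i<u div s. ?X ^ (u mod s + s * i))"
    using gap_sum_root_filter[OF _ _ _ _ S s u m, of fls_const "\<lambda>n. ?X ^ n"]
    by (simp add: laurent_eval_gap_poly power_mult_distrib fls_const_mult_const fls_plus_const)
  also have "\<dots> = of_nat s * ?X ^ (u mod s) * (\<Sum>i<u div s. (?X ^ s) ^ i)"
    by (simp add: power_add sum_distrib_left mult.assoc flip: power_mult)
  finally have sum: "(\<Sum>j<s. fls_const (eps s powi - (int j * m)) *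
        laurent_eval (gap_poly S) (fls_const (eps s ^ j) * ?X)) =
      of_nat s * ?X ^ (u mod s) * (\<Sum>i<u div s. (?X ^ s) ^ i)" .
  have "of_nat s * ?X ^ (u mod s) \<noteq> 0"
    using s(2) by simp
  moreover have "p / c * (c * r) = p * r" if "c \<noteq> 0" for p c r :: "complex fls"
    using that by simp
  ultimately have cancel:
    "p / (of_nat s * ?X ^ (u mod s)) * (of_nat s * ?X ^ (u mod s) * r) = p * r" for p r
    by blast
  have "1 + (?X ^ s - 1) * (\<Sum>i<u div s. (?X ^ s) ^ i) = (?X ^ s) ^ (u div s)"
    by (simp only: power_diff_1_eq[symmetric]) simp
  also have "\<dots> = ?X ^ (s * (u div s))"
    by (simp only: power_mult)
  also have "\<dots> = ?X powi (int s * \<lfloor>real u / real s\<rfloor>)"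
    by (simp only: floor_divide_of_nat_eq of_nat_mult[symmetric] power_int_of_nat)
  finally show ?thesis
    unfolding sum cancel by (rule sym)
qed

lemma apery_floor_identity:
  assumes S: "numerical_semigroup S" and s: "s \<in> S" "s \<noteq> 0" and u: "u \<in> apery_set S s"
    and m: "[m = int u] (mod int s)"
  shows "of_int \<lfloor>real u / real s\<rfloor> =
    1 / of_nat s * (\<Sum>j<s. eps s powi - (int j * m) * poly (gap_poly S) (eps s ^ j))"
proof -
  have "(\<Sum>j<s. eps s powi - (int j * m) * poly (gap_poly S) (eps s ^ j)) =
      of_nat s * of_nat (u div s)"
    using gap_sum_root_filter[OF _ _ _ _ S s u m, of id "\<lambda>n. 1"]
    by (simp add: poly_gap_poly)
  thus ?thesis
    using s(2) by (simp add: floor_divide_of_nat_eq)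
qed

section \<open>Semigroups with two generators\<close>

text \<open>
  Every \<open>n \<ge> a b\<close> lies in the semigroup: some multiple \<open>a k\<close> with \<open>k < b\<close> is congruent
  to \<open>n\<close> modulo \<open>b\<close>, and \<open>a k \<le> a b \<le> n\<close>.
\<close>

lemma numerical_semigroup_semigroup2:
  assumes "b > 0" "coprime a b"
  shows "numerical_semigroup (semigroup2 a b)"
proof -
  have "n \<in> semigroup2 a b" if n: "a * b \<le> n" for n
  proof -
    obtain x where "[a * x = 1] (mod b)"
      using cong_solve_coprime_nat[OF assms(2)] by auto
    hence "[a * x * n = 1 * n] (mod b)"
      by (rule cong_scalar_right)
    hence cong: "[a * (x * n mod b) = n] (mod b)"
      by (simp add: cong_def mod_mult_right_eq mult.assoc)
    have "a * (x * n mod b) \<le> a * b"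
      using assms(1) by (simp add: less_imp_le)
    then have "a * (x * n mod b) \<le> n"
      using n by linarith
    then obtain y where "n = a * (x * n mod b) + b * y"
      using cong cong_le_nat by (metis add.commute mult.commute cong_sym)
    hence "n = (x * n mod b) * a + y * b"
      by (simp only: mult.commute)
    thus ?thesis
      unfolding semigroup2_def by blast
  qed
  hence "- semigroup2 a b \<subseteq> {..<a * b}"
    by (meson ComplD lessThan_iff not_le subsetI)
  hence "finite (- semigroup2 a b)"
    using finite_subset by blast
  moreover have "x + y \<in> semigroup2 a b"
    if xy: "x \<in> semigroup2 a b" "y \<in> semigroup2 a b" for x y
  proof -
    obtain p q p' q' where "x = p * a + q * b" "y = p' * a + q' * b"
      using xy unfolding semigroup2_def by blast
    hence "x + y = (p + p') * a + (q + q') * b"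
      by (simp add: algebra_simps)
    thus ?thesis
      unfolding semigroup2_def by blast
  qed
  moreover have "0 \<in> semigroup2 a b"
    unfolding semigroup2_def by (rule CollectI, rule exI[of _ 0], rule exI[of _ 0]) simp
  ultimately show ?thesis
    by (simp add: numerical_semigroup_def)
qed

lemma generator_in_semigroup2: "b \<in> semigroup2 a b"
  unfolding semigroup2_def by (rule CollectI, rule exI[of _ 0], rule exI[of _ 1]) simp

text \<open>
  If \<open>a k - b = x a + y b\<close>, then \<open>b\<close> divides \<open>a (k - x)\<close> and, by coprimality,
  \<open>k - x\<close>. As \<open>0 \<le> k - x < b\<close>, this forces \<open>k = x\<close> and \<open>(y + 1) b = 0\<close>,
  which is absurd.
\<close>

lemma multiple_in_apery_set:
  assumes ab: "a > 0" "b > 0" "coprime a b" and k: "k < b"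
  shows "a * k \<in> apery_set (semigroup2 a b) b"
proof -
  have "int (a * k) - int b \<notin> int ` semigroup2 a b"
  proof
    assume "int (a * k) - int b \<in> int ` semigroup2 a b"
    then obtain x y where "int (a * k) - int b = int (x * a + y * b)"
      by (auto simp: semigroup2_def)
    hence "int (a * k) = int (x * a + y * b + b)"
      by simp
    hence eq: "a * k = x * a + y * b + b"
      by (simp only: of_nat_eq_iff)
    hence "a * x \<le> a * k"
      by (simp add: mult.commute)
    hence "x \<le> k"
      using ab by simp
    then obtain d where d: "k = x + d"
      using le_iff_add by blast
    have ad: "a * d = (y + 1) * b"
      using eq unfolding d by (simp add: algebra_simps)
    hence "b dvd a * d"
      by simp
    hence "b dvd d"
      using ab(3) by (simp add: coprime_commute coprime_dvd_mult_right_iff)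
    hence "d = 0"
      using k d by (metis add_lessD1 add.commute dvd_imp_le neq0_conv not_less)
    thus False
      using ad ab by simp
  qed
  moreover have "a * k \<in> semigroup2 a b"
    unfolding semigroup2_def by (rule CollectI, rule exI[of _ k], rule exI[of _ 0]) simp
  ultimately show ?thesis
    by (simp add: apery_set_def)
qed

section \<open>The floor identities\<close>

theorem mainTheorem1:
  "(\<forall>(S :: nat set) (s :: nat) (\<alpha> :: nat \<Rightarrow> nat).
      numerical_semigroup S \<longrightarrow> s \<in> S \<longrightarrow> s \<noteq> 0 \<longrightarrow>
      apery_set S s = \<alpha> ` {..<s} \<longrightarrow> (\<forall>k<s. [\<alpha> k = k] (mod s)) \<longrightarrow>
      (\<forall>k<s.
        fls_X powi (int s * \<lfloor>real (\<alpha> k) / real s\<rfloor>) =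
          1 + (fls_X ^ s - 1) / (of_nat s * fls_X ^ k) *
            (\<Sum>j<s. fls_const (eps s powi - (int j * int k)) *
                    laurent_eval (gap_poly S) (fls_const (eps s ^ j) * fls_X)) \<and>
        of_int \<lfloor>real (\<alpha> k) / real s\<rfloor> =
          1 / of_nat s *
            (\<Sum>j<s. eps s powi - (int j * int k) * poly (gap_poly S) (eps s ^ j)))) \<and>
   (\<forall>(a :: nat) (b :: nat).
      a > 0 \<longrightarrow> b > 0 \<longrightarrow> coprime a b \<longrightarrow>
      (\<forall>k<b.
        fls_X powi (int b * \<lfloor>real (a * k) / real b\<rfloor>) =
          1 + (fls_X ^ b - 1) / (of_nat b * fls_X ^ (a * k mod b)) *
            (\<Sum>j<b. fls_const (eps b powi - (int j * int a * int k)) *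
                    laurent_eval (gap_poly (semigroup2 a b)) (fls_const (eps b ^ j) * fls_X)) \<and>
        of_int \<lfloor>real (a * k) / real b\<rfloor> =
          1 / of_nat b *
            (\<Sum>j<b. eps b powi - (int j * int a * int k) *
                    poly (gap_poly (semigroup2 a b)) (eps b ^ j))))"
proof (intro conjI allI impI, goal_cases)
  case (1 S s \<alpha> k)
  hence "\<alpha> k \<in> apery_set S s" "[int k = int (\<alpha> k)] (mod int s)" "\<alpha> k mod s = k"
    by (simp_all add: cong_int_iff cong_sym) (simp add: cong_def)
  thus ?case
    using apery_laurent_identity[of S s "\<alpha> k" "int k"] 1 by simp
next
  case (2 S s \<alpha> k)
  hence "\<alpha> k \<in> apery_set S s" "[int k = int (\<alpha> k)] (mod int s)"
    by (simp_all add: cong_int_iff cong_sym)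
  thus ?case
    using apery_floor_identity[of S s "\<alpha> k" "int k"] 2 by simp
next
  case (3 a b k)
  thus ?case
    using apery_laurent_identity[OF numerical_semigroup_semigroup2 generator_in_semigroup2 _
        multiple_in_apery_set, of b a k "int a * int k"]
    by (simp add: mult.assoc)
next
  case (4 a b k)
  thus ?case
    using apery_floor_identity[OF numerical_semigroup_semigroup2 generator_in_semigroup2 _
        multiple_in_apery_set, of b a k "int a * int k"]
    by (simp add: mult.assoc)
qed

end
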